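(* Let $G$ be a finite group with a nontrivial proper normal subgroup $H$. Then the normal subgroup based power graph $\Gamma_H(G)$ is neither bipartite nor a tree.
   Context: For a finite group $G$ with identity $e$ and a normal subgroup $H$ of $G$, the normal subgroup based power graph $\Gamma_H(G)$ is the simple undirected graph with vertex set $V(\Gamma_H(G))=(G\setminus H)\cup\{e\}$, in which two distinct vertices $x,y$ are adjacent if and only if $xH=y^mH$ or $yH=x^nH$ for some $m,n\in\mathbb{N}$. Here $\mathbb{N}$ denotes the positive integers. Nontrivial proper means $H\neq\{e\}$ and $H\neq G$. *)

theory Defs
  imports "HOL-Algebra.Coset" "Graph_Theory.Digraph_Component"
begin

text \<open>
  Simple undirected graphs are represented as in \<^locale>\<open>pair_graph\<close>: each edge is given by both
  of its orientations.
\<close>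

definition normal_subgroup_power_graph :: "('a, 'm) monoid_scheme \<Rightarrow> 'a set \<Rightarrow> 'a pair_pre_digraph" where
  "normal_subgroup_power_graph G H =
     (let V = (carrier G - H) \<union> {\<one>\<^bsub>G\<^esub>} in
      \<lparr> pverts = V,
        parcs = {(x, y). x \<in> V \<and> y \<in> V \<and> x \<noteq> y \<and>
          ((\<exists>m::nat. m > 0 \<and> x <#\<^bsub>G\<^esub> H = (y [^]\<^bsub>G\<^esub> m) <#\<^bsub>G\<^esub> H) \<or>
           (\<exists>n::nat. n > 0 \<and> y <#\<^bsub>G\<^esub> H = (x [^]\<^bsub>G\<^esub> n) <#\<^bsub>G\<^esub> H))} \<rparr>)"

lemma pair_graph_normal_subgroup_power_graph:
  assumes "finite (carrier G)"
  shows "pair_graph (normal_subgroup_power_graph G H)"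
proof -
  let ?P = "normal_subgroup_power_graph G H"
  have fin: "finite (pverts ?P)"
    using assms by (simp add: normal_subgroup_power_graph_def Let_def)
  have sub: "parcs ?P \<subseteq> pverts ?P \<times> pverts ?P"
    by (auto simp: normal_subgroup_power_graph_def Let_def)
  have symm: "sym (parcs ?P)"
    unfolding normal_subgroup_power_graph_def Let_def sym_def by auto
  show ?thesis
  proof
    show "finite (pverts ?P)" by (rule fin)
    show "finite (parcs ?P)" using fin sub by (meson finite_SigmaI finite_subset)
    show "symmetric (with_proj ?P)"
      using symm by (simp add: symmetric_def)
  qed (auto simp: normal_subgroup_power_graph_def Let_def)
qed

definition bipartite :: "('a, 'b) pre_digraph \<Rightarrow> bool" where
  "bipartite \<Gamma> \<longleftrightarrow>
     (\<exists>U W. verts \<Gamma> = U \<union> W \<and> U \<inter> W = {} \<and>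
        (\<forall>a \<in> arcs \<Gamma>. (tail \<Gamma> a \<in> U \<and> head \<Gamma> a \<in> W) \<or> (tail \<Gamma> a \<in> W \<and> head \<Gamma> a \<in> U)))"

text \<open>
  The library predicate \<^const>\<open>tree\<close> is not suitable for undirected graphs: there, an edge
  traversed back and forth is a \<^const>\<open>pre_digraph.cycle\<close> of length 2, so no symmetric digraph with
  an edge would be a tree. A cycle of a simple undirected graph has length at least 3.
\<close>

definition undirected_tree :: "('a, 'b) pre_digraph \<Rightarrow> bool" where
  "undirected_tree \<Gamma> \<longleftrightarrow>
     connected \<Gamma> \<and> \<not> (\<exists>p. pre_digraph.cycle \<Gamma> p \<and> 3 \<le> length p)"

end

theory Submission
  imports Defs "HOL-Algebra.Multiplicative_Group"
begin

text \<open>The graph contains a triangle, which is both an odd cycle and a cycle of length 3, so it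
  rules out both properties. Choose \<open>x\<close> outside \<open>H\<close> and \<open>h\<close>
  in \<open>H\<close> with \<open>h\<close> not the identity; the triangle is formed by the
  identity, \<open>x\<close> and \<open>x h\<close>. The vertices \<open>x\<close> and
  \<open>x h\<close> are adjacent because they represent the same coset of \<open>H\<close>. The
  identity is adjacent to every other vertex, since each element of a finite group has a positive
  power equal to it.\<close>

lemma not_bipartite_if_triangle:
  assumes "(a, b) \<in> parcs P" "(b, c) \<in> parcs P" "(c, a) \<in> parcs P"
  shows "\<not> bipartite (with_proj P)"
proof
  assume "bipartite (with_proj P)"
  then obtain U W where disjoint: "U \<inter> W = {}"
    and arcs: "\<forall>e \<in> parcs P. fst e \<in> U \<and> snd e \<in> W \<or> fst e \<in> W \<and> snd e \<in> U"
    unfolding bipartite_def by auto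
  show False
    using bspec[OF arcs assms(1)] bspec[OF arcs assms(2)] bspec[OF arcs assms(3)] disjoint
    by auto
qed

text \<open>The closed walk around the triangle repeats no vertex except its start, and its length
  is exactly the minimum that \<open>undirected_tree\<close> forbids.\<close>

lemma not_undirected_tree_if_triangle:
  assumes "(a, b) \<in> parcs P" "(b, c) \<in> parcs P" "(c, a) \<in> parcs P"
    and "distinct [a, b, c]" and "a \<in> pverts P"
  shows "\<not> undirected_tree (with_proj P)"
proof -
  have "pre_digraph.cycle (with_proj P) [(a, b), (b, c), (c, a)]"
    using assms
    by (auto simp: pre_digraph.cycle_def pre_digraph.awalk_def pre_digraph.cas.simps
        pre_digraph.awalk_verts.simps)
  moreover have "3 \<le> length [(a, b), (b, c), (c, a)]"
    by simp
  ultimately show ?thesis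
    unfolding undirected_tree_def by blast
qed

text \<open>Adjacency is a disjunction symmetric in \<open>x\<close> and \<open>y\<close>, so one
  coset equation yields both orientations. The triangle uses both: it leaves and re-enters the
  identity through equations of the same shape.\<close>

lemma parcs_normal_subgroup_power_graphI:
  assumes "x \<in> insert \<one>\<^bsub>G\<^esub> (carrier G - H)" "y \<in> insert \<one>\<^bsub>G\<^esub> (carrier G - H)" "x \<noteq> y"
    and "\<exists>m::nat. m > 0 \<and> x <#\<^bsub>G\<^esub> H = (y [^]\<^bsub>G\<^esub> m) <#\<^bsub>G\<^esub> H"
  shows "(x, y) \<in> parcs (normal_subgroup_power_graph G H)"
    and "(y, x) \<in> parcs (normal_subgroup_power_graph G H)"
  using assms by (simp_all add: normal_subgroup_power_graph_def)

theorem corollary5p2: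
  fixes G :: "('a, 'm) monoid_scheme" and H :: "'a set"
  assumes "group G"
    and "finite (carrier G)"
    and "H \<lhd> G"
    and "H \<noteq> {\<one>\<^bsub>G\<^esub>}"
    and "H \<noteq> carrier G"
  shows "\<not> bipartite (with_proj (normal_subgroup_power_graph G H)) \<and>
         \<not> undirected_tree (with_proj (normal_subgroup_power_graph G H))"
proof -
  interpret group G by fact
  interpret normal H G by fact
  let ?P = "normal_subgroup_power_graph G H"
  obtain h where h: "h \<in> H" "h \<noteq> \<one>\<^bsub>G\<^esub>"
    using assms(4) one_closed by blast
  obtain x where x: "x \<in> carrier G" "x \<notin> H"
    using assms(5) subset by blast
  \<comment> \<open>A second representative of the coset of \<open>x\<close>, distinct from
    \<open>x\<close> because \<open>h\<close> is not the identity.\<close>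
  define y where "y = x \<otimes>\<^bsub>G\<^esub> h"
  have y: "y \<in> carrier G" "y \<noteq> x" "y \<in> x <#\<^bsub>G\<^esub> H"
    using h x by (auto simp: y_def l_coset_def)
  have coset_eq: "x <#\<^bsub>G\<^esub> H = y <#\<^bsub>G\<^esub> H"
    using l_repr_independence y(3) x(1) is_subgroup by blast
  \<comment> \<open>This makes \<open>y\<close> a vertex: otherwise cancelling \<open>h\<close>
    would put \<open>x\<close> in \<open>H\<close>.\<close>
  have yH: "y \<notin> H"
  proof
    assume "y \<in> H"
    then have "y \<otimes>\<^bsub>G\<^esub> inv\<^bsub>G\<^esub> h \<in> H" using h by blast
    then show False using x h by (simp add: y_def m_assoc)
  qed
  \<comment> \<open>The exponent witness below is \<open>order G\<close>; adjacency demands a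
    positive exponent, which finiteness guarantees here.\<close>
  have "order G > 0"
    using assms(2) by (simp add: order_gt_0_iff_finite)
  then have power_eq_one: "\<exists>n::nat. n > 0 \<and> \<one>\<^bsub>G\<^esub> <#\<^bsub>G\<^esub> H = (z [^]\<^bsub>G\<^esub> n) <#\<^bsub>G\<^esub> H"
    if "z \<in> carrier G" for z
    using that by (intro exI[of _ "order G"]) (simp add: pow_order_eq_1)
  have triangle: "(\<one>\<^bsub>G\<^esub>, x) \<in> parcs ?P" "(x, y) \<in> parcs ?P" "(y, \<one>\<^bsub>G\<^esub>) \<in> parcs ?P"
  proof -
    have "\<one>\<^bsub>G\<^esub> \<noteq> x" "\<one>\<^bsub>G\<^esub> \<noteq> y"
      using x(2) yH by auto
    then show "(\<one>\<^bsub>G\<^esub>, x) \<in> parcs ?P" "(y, \<one>\<^bsub>G\<^esub>) \<in> parcs ?P"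
      using x y(1) yH power_eq_one[of x] power_eq_one[of y]
      by (simp_all add: parcs_normal_subgroup_power_graphI)
    \<comment> \<open>Equal cosets give adjacency already with exponent 1.\<close>
    have "\<exists>m::nat. m > 0 \<and> x <#\<^bsub>G\<^esub> H = (y [^]\<^bsub>G\<^esub> m) <#\<^bsub>G\<^esub> H"
      using coset_eq y(1) by (intro exI[of _ 1]) simp
    then show "(x, y) \<in> parcs ?P"
      using x y(1,2) yH by (intro parcs_normal_subgroup_power_graphI(1)) blast+
  qed
  have "distinct [\<one>\<^bsub>G\<^esub>, x, y]" "\<one>\<^bsub>G\<^esub> \<in> pverts ?P"
    using x y(2) yH by (auto simp: normal_subgroup_power_graph_def Let_def)
  then show ?thesis
    using not_bipartite_if_triangle[OF triangle] not_undirected_tree_if_triangle[OF triangle]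
    by blast
qed

end
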